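(* Let $\wp \geq 3$ be an integer and let $T_{\wp}\langle 1, \wp-2\rangle$ be the Toeplitz graph on $\{1,\dots,\wp\}$ with generating set $\{1,\wp-2\}$. If $\wp$ is odd, then $\mathrm{ldim}_{\mathrm{f}}(T_{\wp}\langle 1, \wp-2\rangle)=1$. If $\wp$ is even, then $$\frac{\wp}{\wp-1}\leq \mathrm{ldim}_{\mathrm{f}}(T_{\wp}\langle 1, \wp-2\rangle)\leq \frac{\wp}{\wp-2}.$$
   Context: For a positive integer $n$ and $S\subseteq\{1,\dots,n\}$, the Toeplitz graph $T_n\langle S\rangle$ has vertex set $\{1,2,\dots,n\}$, and distinct vertices $p,q$ are adjacent iff $|p-q|\in S$. For a finite simple graph $G$ with shortest-path distance $d$, and vertices $v,w$, the resolving neighborhood is $\mathcal{R}\{v,w\}=\{u\in V(G): d(u,v)\neq d(u,w)\}$. A local resolving function of $G$ is a map $\zeta:V(G)\to[0,1]$ such that $\sum_{u\in\mathcal{R}\{v,w\}}\zeta(u)\geq 1$ for every edge $vw$ of $G$. The local fractional metric dimension is $\mathrm{ldim}_{\mathrm{f}}(G)=\min\{\sum_{v\in V(G)}\zeta(v): \zeta \text{ a local resolving function of } G\}$. *)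

theory Defs
  imports Complex_Main "Graph_Theory.Pair_Digraph" "Graph_Theory.Shortest_Path"
begin

text \<open>
  A finite simple graph is a \<open>pair_graph\<close>: finite, loop-free and symmetric, so that an undirected
  edge is represented by its two arcs.
\<close>

definition toeplitz_graph :: "nat \<Rightarrow> nat set \<Rightarrow> nat pair_pre_digraph" where
  "toeplitz_graph n S =
    \<lparr> pverts = {1..n},
      parcs = {(p, q). p \<in> {1..n} \<and> q \<in> {1..n} \<and> p \<noteq> q \<and> nat \<bar>int p - int q\<bar> \<in> S} \<rparr>"

lemma pair_graph_toeplitz_graph: "pair_graph (toeplitz_graph n S)"
proof -
  have "parcs (toeplitz_graph n S) \<subseteq> {1..n} \<times> {1..n}"
    by (auto simp: toeplitz_graph_def)
  then have "finite (parcs (toeplitz_graph n S))"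
    by (rule finite_subset) simp
  then show ?thesis
    by unfold_locales
      (auto simp: toeplitz_graph_def symmetric_def sym_def abs_minus_commute)
qed

text \<open>The unit-cost shortest walk; its value is infinite when no walk exists.\<close>

definition graph_dist :: "'a pair_pre_digraph \<Rightarrow> 'a \<Rightarrow> 'a \<Rightarrow> ereal" where
  "graph_dist G u v = wf_digraph.\<mu> (with_proj G) (\<lambda>_. 1) u v"

definition resolving_nbhd :: "'a pair_pre_digraph \<Rightarrow> 'a \<Rightarrow> 'a \<Rightarrow> 'a set" where
  "resolving_nbhd G v w = {u \<in> pverts G. graph_dist G u v \<noteq> graph_dist G u w}"

definition local_resolving_function :: "'a pair_pre_digraph \<Rightarrow> ('a \<Rightarrow> real) \<Rightarrow> bool" where
  "local_resolving_function G \<zeta> \<longleftrightarrow>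
    \<zeta> \<in> pverts G \<rightarrow> {0..1} \<and>
    (\<forall>(v, w) \<in> parcs G. (\<Sum>u \<in> resolving_nbhd G v w. \<zeta> u) \<ge> 1)"

text \<open>
  \<open>LEAST\<close> over the reals denotes the minimum only if it is attained, so a statement about its value
  includes the existence of an optimal local resolving function.
\<close>

definition ldim_f :: "'a pair_pre_digraph \<Rightarrow> real" where
  "ldim_f G = (LEAST r. \<exists>\<zeta>. local_resolving_function G \<zeta> \<and> r = (\<Sum>v \<in> pverts G. \<zeta> v))"

end

theory Submission
  imports Defs
begin

text \<open>
  The vertices \<open>1\<close> and \<open>n\<close> of \<open>T\<^sub>n\<langle>1, n - 2\<rangle>\<close> are non-adjacent twins, and the graph is the cycle
  on \<open>1, \<dots>, n - 1\<close> with the vertex \<open>1\<close> doubled (for \<open>n = 3\<close> the cycle is a single edge). If \<open>n\<close> is odd, this cycle is even, so the graph is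
  bipartite, every vertex resolves every edge, and all the weight can be put on one vertex.
  If \<open>n\<close> is even, the cycle is odd, and each edge is left unresolved by exactly one vertex of the
  cycle, the one opposite to it (together with its twin). Summing the \<open>n - 1\<close> resulting constraints
  shows that the total weight is at least \<open>(n - 1) / (n - 2)\<close>, and the uniform weight \<open>1 / (n - 2)\<close> on
  the cycle attains this; the value lies between the two bounds.
\<close>

section \<open>Certificates for distances and for the minimum\<close>

text \<open>A function \<open>f\<close> with these properties is a certificate for the distances
  from \<open>u\<close>: the Lipschitz condition telescopes along a walk and bounds its cost from
  below, while following \<open>descent\<close> back to \<open>u\<close> yields a walk of cost
  exactly \<open>f v\<close>.\<close>

lemma graph_dist_eqI:
  fixes f :: "'a \<Rightarrow> nat"
  assumes G: "pair_wf_digraph G"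
    and u: "u \<in> pverts G" and v: "v \<in> pverts G"
    and start: "f u = 0"
    and lipschitz: "\<And>x y. (x, y) \<in> parcs G \<Longrightarrow> f y \<le> Suc (f x)"
    and descent: "\<And>y. y \<in> pverts G \<Longrightarrow> y \<noteq> u \<Longrightarrow> \<exists>x. (x, y) \<in> parcs G \<and> Suc (f x) = f y"
  shows "graph_dist G u v = ereal (real (f v))"
proof -
  interpret pair_wf_digraph G by (rule G)
  have lower: "real (f y) \<le> real (f x) + awalk_cost (\<lambda>_. 1) p" if "awalk x p y" for x p y
    using that
  proof (induction p arbitrary: x)
    case Nil
    then show ?case by (simp add: awalk_simps)
  next
    case (Cons e p)
    then have "e \<in> parcs G" "fst e = x" "awalk (snd e) p y"
      by (auto simp: awalk_simps)
    with Cons.IH[of "snd e"] lipschitz[of x "snd e"] show ?case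
      by (cases e) auto
  qed
  have upper: "\<exists>p. awalk u p y \<and> awalk_cost (\<lambda>_. 1) p = real (f y)" if "y \<in> pverts G" for y
    using that
  proof (induction "f y" arbitrary: y rule: less_induct)
    case less
    show ?case
    proof (cases "y = u")
      case True
      then show ?thesis using u start by (intro exI[of _ "[]"]) (simp add: awalk_simps)
    next
      case False
      with less.prems obtain x where x: "(x, y) \<in> parcs G" "Suc (f x) = f y"
        using descent by blast
      moreover have "x \<in> pverts G" using x(1) in_arcsD1 by blast
      ultimately obtain p where p: "awalk u p x" "awalk_cost (\<lambda>_. 1) p = real (f x)"
        using less.hyps[of x] by auto
      have "awalk u (p @ [(x, y)]) y"
        using p(1) x(1) less.prems by (auto simp: awalk_simps)
      moreover have "awalk_cost (\<lambda>_. 1) (p @ [(x, y)]) = real (f y)"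
        using p(2) x(2) by simp
      ultimately show ?thesis by blast
    qed
  qed
  show ?thesis
    unfolding graph_dist_def \<mu>_def
  proof (rule antisym)
    show "(INF p\<in>{p. awalk u p v}. ereal (awalk_cost (\<lambda>_. 1) p)) \<le> ereal (real (f v))"
      using upper[OF v] by (auto intro!: INF_lower2)
    show "ereal (real (f v)) \<le> (INF p\<in>{p. awalk u p v}. ereal (awalk_cost (\<lambda>_. 1) p))"
      using lower[of u _ v] start by (auto intro!: INF_greatest)
  qed
qed

lemma ldim_f_eqI:
  assumes "local_resolving_function G \<zeta>" and "(\<Sum>v \<in> pverts G. \<zeta> v) = r"
    and "\<And>\<eta>. local_resolving_function G \<eta> \<Longrightarrow> r \<le> (\<Sum>v \<in> pverts G. \<eta> v)"
  shows "ldim_f G = r"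
  unfolding ldim_f_def using assms by (intro Least_equality) auto

section \<open>The doubled cycle and its distances\<close>

definition doubled_cycle :: "nat \<Rightarrow> nat pair_pre_digraph" where
  "doubled_cycle n = toeplitz_graph n {1, n - 2}"

text \<open>Folds the graph onto the cycle \<open>1, ..., n - 1\<close> by identifying the twin
  \<open>n\<close> with \<open>1\<close>.\<close>

definition untwin :: "nat \<Rightarrow> nat \<Rightarrow> nat" where
  "untwin n v = (if v = n then 1 else v)"

definition cycle_dist :: "nat \<Rightarrow> nat \<Rightarrow> nat \<Rightarrow> nat" where
  "cycle_dist m a b = (if a \<le> b then min (b - a) (m - (b - a)) else min (a - b) (m - (a - b)))"

text \<open>The value 2 is for the twins \<open>1\<close> and \<open>n\<close>, which are not
  adjacent but share the neighbour 2; all other pairs of distinct vertices are as far apart as their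
  images in the cycle.\<close>

definition doubled_cycle_dist :: "nat \<Rightarrow> nat \<Rightarrow> nat \<Rightarrow> nat" where
  "doubled_cycle_dist n u v =
    (if u = v then 0 else if untwin n u = untwin n v then 2
     else cycle_dist (n - 1) (untwin n u) (untwin n v))"

lemmas doubled_cycle_dist_defs = doubled_cycle_dist_def untwin_def cycle_dist_def

lemma pverts_doubled_cycle [simp]: "pverts (doubled_cycle n) = {1..n}"
  by (simp add: doubled_cycle_def toeplitz_graph_def)

lemma parcs_doubled_cycle:
  assumes "n \<ge> 3"
  shows "(p, q) \<in> parcs (doubled_cycle n) \<longleftrightarrow> p \<in> {1..n} \<and> q \<in> {1..n} \<and>
    (q = p + 1 \<or> p = q + 1 \<or> q + 2 = p + n \<or> p + 2 = q + n)"
  using assms by (auto simp: doubled_cycle_def toeplitz_graph_def)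

text \<open>Folding sends arcs to edges of the cycle: the edges at \<open>n\<close> lead to 2 and
  \<open>n - 1\<close>, and these become edges at 1. The ends are ordered as \<open>a < b\<close>,
  so that only the closing edge from 1 to \<open>n - 1\<close> is special.\<close>

lemma untwin_arc_cases:
  assumes "n \<ge> 3" "(v, w) \<in> parcs (doubled_cycle n)"
  obtains a b where "untwin n v = a \<and> untwin n w = b \<or> untwin n v = b \<and> untwin n w = a"
    and "1 \<le> a" "a < b" "b \<le> n - 1" "b = a + 1 \<or> a = 1 \<and> b = n - 1"
proof -
  have "v \<in> {1..n}" "w \<in> {1..n}" "w = v + 1 \<or> v = w + 1 \<or> w + 2 = v + n \<or> v + 2 = w + n"
    using assms by (simp_all add: parcs_doubled_cycle)
  then have "\<exists>a b. (untwin n v = a \<and> untwin n w = b \<or> untwin n v = b \<and> untwin n w = a) \<and>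
    1 \<le> a \<and> a < b \<and> b \<le> n - 1 \<and> (b = a + 1 \<or> a = 1 \<and> b = n - 1)"
    using assms(1)
    by (intro exI[of _ "min (untwin n v) (untwin n w)"] exI[of _ "max (untwin n v) (untwin n w)"])
      (elim disjE; auto simp: untwin_def)
  then show ?thesis using that by blast
qed

lemma cycle_dist_self [simp]: "cycle_dist m a a = 0"
  by (simp add: cycle_dist_def)

lemma cycle_dist_adjacent:
  assumes "1 \<le> a" "a < b" "b \<le> m" "b = a + 1 \<or> a = 1 \<and> b = m"
  shows "cycle_dist m a b = 1" "cycle_dist m b a = 1"
  using assms by (auto simp: cycle_dist_def)

lemma cycle_dist_lipschitz:
  assumes "1 \<le> a" "a < b" "b \<le> m" "b = a + 1 \<or> a = 1 \<and> b = m" "1 \<le> u" "u \<le> m"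
  shows "cycle_dist m u b \<le> Suc (cycle_dist m u a)" "cycle_dist m u a \<le> Suc (cycle_dist m u b)"
  using assms by (auto simp: cycle_dist_def)

lemma doubled_cycle_dist_cases:
  obtains "untwin n u \<noteq> untwin n v"
      "doubled_cycle_dist n u v = cycle_dist (n - 1) (untwin n u) (untwin n v)"
  | "untwin n u = untwin n v" "doubled_cycle_dist n u v = 0 \<or> doubled_cycle_dist n u v = 2"
  by (cases "untwin n u = untwin n v") (auto simp: doubled_cycle_dist_def)

lemma doubled_cycle_dist_lipschitz:
  assumes n: "n \<ge> 3" and u: "u \<in> {1..n}" and arc: "(v, w) \<in> parcs (doubled_cycle n)"
  shows "doubled_cycle_dist n u w \<le> Suc (doubled_cycle_dist n u v)"
proof -
  obtain a b where ab: "untwin n v = a \<and> untwin n w = b \<or> untwin n v = b \<and> untwin n w = a"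
    "1 \<le> a" "a < b" "b \<le> n - 1" "b = a + 1 \<or> a = 1 \<and> b = n - 1"
    using untwin_arc_cases[OF n arc] .
  have "1 \<le> untwin n u" "untwin n u \<le> n - 1" using n u by (auto simp: untwin_def)
  note facts = cycle_dist_lipschitz[OF ab(2-5) this] cycle_dist_adjacent[OF ab(2-5)] ab(1,3)
  show ?thesis
    by (rule doubled_cycle_dist_cases[of n u v]; rule doubled_cycle_dist_cases[of n u w])
      (use facts in auto)
qed

text \<open>The two distances can differ only if \<open>u\<close> folds to the same vertex as one
  end of the arc. The other end is then at distance 1, whereas this end is at distance 0 or 2 in the
  graph and 0 in the cycle, so both equations fail.\<close>

lemma doubled_cycle_dist_eq_iff:
  assumes n: "n \<ge> 3" and arc: "(v, w) \<in> parcs (doubled_cycle n)"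
  shows "doubled_cycle_dist n u v = doubled_cycle_dist n u w \<longleftrightarrow>
    cycle_dist (n - 1) (untwin n u) (untwin n v) = cycle_dist (n - 1) (untwin n u) (untwin n w)"
proof -
  obtain a b where ab: "untwin n v = a \<and> untwin n w = b \<or> untwin n v = b \<and> untwin n w = a"
    "1 \<le> a" "a < b" "b \<le> n - 1" "b = a + 1 \<or> a = 1 \<and> b = n - 1"
    using untwin_arc_cases[OF n arc] .
  note facts = cycle_dist_adjacent[OF ab(2-5)] ab(1,3)
  show ?thesis
    by (rule doubled_cycle_dist_cases[of n u v]; rule doubled_cycle_dist_cases[of n u w])
      (use facts in auto)
qed

lemma doubled_cycle_dist_descent:
  assumes n: "n \<ge> 3" and u: "u \<in> {1..n}" and y: "y \<in> {1..n}" and "y \<noteq> u"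
  shows "\<exists>x. (x, y) \<in> parcs (doubled_cycle n) \<and>
    Suc (doubled_cycle_dist n u x) = doubled_cycle_dist n u y"
proof -
  let ?P = "\<lambda>x. (x, y) \<in> parcs (doubled_cycle n) \<and>
    Suc (doubled_cycle_dist n u x) = doubled_cycle_dist n u y"
  define a b where "a = untwin n u" and "b = untwin n y"
  have ab: "a \<in> {1..n - 1}" "b \<in> {1..n - 1}" "u = a \<or> u = n \<and> a = 1" "y = b \<or> y = n \<and> b = 1"
    using assms by (auto simp: a_def b_def untwin_def)
  \<comment> \<open>On the cycle, \<open>x \<noteq> a\<close> excludes both \<open>u\<close> and its
    twin, so the exceptional values 0 and 2 do not occur.\<close>
  have dist: "doubled_cycle_dist n u x = cycle_dist (n - 1) a x" if "x \<in> {1..n - 1}" "x \<noteq> a" for x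
    using that ab by (auto simp: doubled_cycle_dist_def untwin_def a_def)
  have dist_y: "doubled_cycle_dist n u y = cycle_dist (n - 1) a b" if "a \<noteq> b"
    using that by (auto simp: doubled_cycle_dist_def a_def b_def)
  \<comment> \<open>Twins have the same neighbours, so adjacency to \<open>b\<close> in the cycle
    gives adjacency to \<open>y\<close>, even for \<open>y = n\<close>.\<close>
  have arcI: "(x, y) \<in> parcs (doubled_cycle n)"
    if "x \<in> {1..n - 1}" "x + 1 = b \<or> x = b + 1 \<or> x + n = b + 2 \<or> x + 2 = b + n" for x
    using that ab n by (auto simp: parcs_doubled_cycle)
  consider "a = b" | "a \<noteq> b" "cycle_dist (n - 1) a b = 1"
    | "cycle_dist (n - 1) a b \<noteq> 1" "a < b" "b - a \<le> n - 1 - (b - a)"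
    | "cycle_dist (n - 1) a b \<noteq> 1" "a < b" "n - 1 - (b - a) < b - a"
    | "cycle_dist (n - 1) a b \<noteq> 1" "b < a" "a - b \<le> n - 1 - (a - b)"
    | "cycle_dist (n - 1) a b \<noteq> 1" "b < a" "n - 1 - (a - b) < a - b"
    by (meson linorder_neqE_nat not_le)
  then show ?thesis
  proof cases
    case 1
    \<comment> \<open>Here \<open>u\<close> and \<open>y\<close> are the two twins, and 2 is a
      common neighbour.\<close>
    then have "?P 2"
      using assms ab
      by (auto simp: parcs_doubled_cycle doubled_cycle_dist_def untwin_def cycle_dist_def)
    then show ?thesis by blast
  next
    case 2
    \<comment> \<open>The predecessor must be \<open>u\<close> itself: its representative
      \<open>a\<close> would be at distance 2 from \<open>u\<close> when
      \<open>u = n\<close>.\<close>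
    then have "(u, y) \<in> parcs (doubled_cycle n)"
      using n ab by (auto simp: parcs_doubled_cycle cycle_dist_def min_def split: if_splits)
    moreover have "doubled_cycle_dist n u y = 1"
      using 2 \<open>y \<noteq> u\<close> by (simp add: doubled_cycle_dist_def a_def b_def)
    ultimately have "?P u" by (simp add: doubled_cycle_dist_def)
    then show ?thesis by blast
  next
    case 3
    \<comment> \<open>In this and the remaining cases, \<open>x\<close> is the neighbour of
      \<open>b\<close> on the shorter way round to \<open>a\<close>; as the distance exceeds 1,
      \<open>x\<close> is not \<open>a\<close>.\<close>
    define x where "x = b - 1"
    have "1 < b - a"
      using 3 ab(1,2) by (simp add: cycle_dist_def)
    with 3 have x: "x \<in> {1..n - 1}" "x \<noteq> a"
      "x + 1 = b \<or> x = b + 1 \<or> x + n = b + 2 \<or> x + 2 = b + n"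
      and "Suc (cycle_dist (n - 1) a x) = cycle_dist (n - 1) a b"
      using ab(1,2) by (auto simp: x_def cycle_dist_def)
    then have "?P x" using 3 arcI[OF x(1,3)] dist[OF x(1,2)] dist_y by simp
    then show ?thesis by blast
  next
    case 4
    \<comment> \<open>The shorter way runs upwards and may wrap from \<open>n - 1\<close> to
      1.\<close>
    define x where "x = (if b = n - 1 then 1 else b + 1)"
    have "1 < n - 1 - (b - a)"
      using 4 ab(1,2) by (simp add: cycle_dist_def)
    with 4 have x: "x \<in> {1..n - 1}" "x \<noteq> a"
      "x + 1 = b \<or> x = b + 1 \<or> x + n = b + 2 \<or> x + 2 = b + n"
      and "Suc (cycle_dist (n - 1) a x) = cycle_dist (n - 1) a b"
      using ab(1,2) by (auto simp: x_def cycle_dist_def)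
    then have "?P x" using 4 arcI[OF x(1,3)] dist[OF x(1,2)] dist_y by simp
    then show ?thesis by blast
  next
    case 5
    define x where "x = b + 1"
    have "1 < a - b"
      using 5 ab(1,2) by (simp add: cycle_dist_def)
    with 5 have x: "x \<in> {1..n - 1}" "x \<noteq> a"
      "x + 1 = b \<or> x = b + 1 \<or> x + n = b + 2 \<or> x + 2 = b + n"
      and "Suc (cycle_dist (n - 1) a x) = cycle_dist (n - 1) a b"
      using ab(1,2) by (auto simp: x_def cycle_dist_def)
    then have "?P x" using 5 arcI[OF x(1,3)] dist[OF x(1,2)] dist_y by simp
    then show ?thesis by blast
  next
    case 6
    define x where "x = (if b = 1 then n - 1 else b - 1)"
    have "1 < n - 1 - (a - b)"
      using 6 ab(1,2) by (simp add: cycle_dist_def)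
    with 6 have x: "x \<in> {1..n - 1}" "x \<noteq> a"
      "x + 1 = b \<or> x = b + 1 \<or> x + n = b + 2 \<or> x + 2 = b + n"
      and "Suc (cycle_dist (n - 1) a x) = cycle_dist (n - 1) a b"
      using ab(1,2) by (auto simp: x_def cycle_dist_def)
    then have "?P x" using 6 arcI[OF x(1,3)] dist[OF x(1,2)] dist_y by simp
    then show ?thesis by blast
  qed
qed

lemma graph_dist_doubled_cycle:
  assumes "n \<ge> 3" "u \<in> {1..n}" "v \<in> {1..n}"
  shows "graph_dist (doubled_cycle n) u v = ereal (real (doubled_cycle_dist n u v))"
proof (rule graph_dist_eqI)
  show "pair_wf_digraph (doubled_cycle n)"
    unfolding doubled_cycle_def
    using pair_graph_toeplitz_graph[of n] pair_graph_def pair_digraph_def pair_fin_digraph_def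
    by metis
  show "doubled_cycle_dist n u u = 0" by (simp add: doubled_cycle_dist_def)
qed (use assms doubled_cycle_dist_lipschitz doubled_cycle_dist_descent in auto)

lemma resolving_nbhd_doubled_cycle:
  assumes "n \<ge> 3" "(v, w) \<in> parcs (doubled_cycle n)"
  shows "resolving_nbhd (doubled_cycle n) v w =
    {u \<in> {1..n}. doubled_cycle_dist n u v \<noteq> doubled_cycle_dist n u w}"
  using assms by (auto simp: resolving_nbhd_def graph_dist_doubled_cycle parcs_doubled_cycle)

section \<open>Vertices that fail to resolve an edge\<close>

text \<open>For even \<open>m\<close>, both ways round from 1 to \<open>a\<close> have the parity of
  \<open>a - 1\<close>, and the ends of every edge, including the closing one, have opposite
  parity.\<close>

lemma even_cycle_dist_neq:
  assumes "even m" "1 \<le> a" "a < b" "b \<le> m" "b = a + 1 \<or> a = 1 \<and> b = m"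
  shows "cycle_dist m 1 a \<noteq> cycle_dist m 1 b"
proof -
  obtain k where "m = 2 * k" using assms(1) by (rule evenE)
  then show ?thesis using assms(2-) by (auto simp: cycle_dist_def min_def) presburger
qed

text \<open>An equidistant vertex lies \<open>k\<close> steps from both ends. From the edge
  \<open>a, a + 1\<close> this leads to \<open>a + 1 + k\<close>, reduced by
  \<open>2 * k + 1\<close> if that exceeds \<open>m\<close>. The explicit formula makes uniqueness
  immediate.\<close>

lemma odd_cycle_dist_eqD:
  assumes m: "m = 2 * k + 1" and "1 \<le> a" "a < b" "b \<le> m" "b = a + 1 \<or> a = 1 \<and> b = m"
    and z: "1 \<le> z" "z \<le> m" and eq: "cycle_dist m z a = cycle_dist m z b"
  shows "z = (if b = a + 1 then if a \<le> k then a + k + 1 else a - k else k + 1)"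
proof (cases "b = a + 1")
  case True
  then show ?thesis
    using z eq assms(2,4) m by (cases "z \<le> a") (auto simp: cycle_dist_def min_def split: if_splits)
next
  case False
  then have "a = 1" "b = m" using assms(5) by auto
  then show ?thesis
    using False z eq m by (auto simp: cycle_dist_def min_def split: if_splits)
qed

lemma one_resolves_doubled_cycle:
  assumes n: "n \<ge> 3" "odd n" and arc: "(v, w) \<in> parcs (doubled_cycle n)"
  shows "doubled_cycle_dist n 1 v \<noteq> doubled_cycle_dist n 1 w"
proof -
  obtain a b where ab: "untwin n v = a \<and> untwin n w = b \<or> untwin n v = b \<and> untwin n w = a"
    "1 \<le> a" "a < b" "b \<le> n - 1" "b = a + 1 \<or> a = 1 \<and> b = n - 1"
    using untwin_arc_cases[OF n(1) arc] .
  have "even (n - 1)" "untwin n 1 = 1" using n by (simp_all add: untwin_def)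
  with even_cycle_dist_neq[OF this(1) ab(2-5)] ab(1) show ?thesis
    unfolding doubled_cycle_dist_eq_iff[OF n(1) arc] by auto
qed

text \<open>Restricted to the cycle because the twins \<open>1\<close> and \<open>n\<close> fail to
  resolve the same edges.\<close>

lemma unresolving_cycle_vertex_unique:
  assumes n: "n \<ge> 3" "even n" and arc: "(v, w) \<in> parcs (doubled_cycle n)"
    and x: "x \<in> {1..n - 1}" "doubled_cycle_dist n x v = doubled_cycle_dist n x w"
    and y: "y \<in> {1..n - 1}" "doubled_cycle_dist n y v = doubled_cycle_dist n y w"
  shows "x = y"
proof -
  obtain a b where ab: "untwin n v = a \<and> untwin n w = b \<or> untwin n v = b \<and> untwin n w = a"
    "1 \<le> a" "a < b" "b \<le> n - 1" "b = a + 1 \<or> a = 1 \<and> b = n - 1"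
    using untwin_arc_cases[OF n(1) arc] .
  have "odd (n - 1)" using n by simp
  then obtain k where "n - 1 = 2 * k + 1" by (rule oddE)
  note opposite = odd_cycle_dist_eqD[OF this ab(2-5)]
  have "cycle_dist (n - 1) z a = cycle_dist (n - 1) z b"
    if "z \<in> {1..n - 1}" "doubled_cycle_dist n z v = doubled_cycle_dist n z w" for z
  proof -
    have "untwin n z = z" using that(1) n by (auto simp: untwin_def)
    with that(2) ab(1) show ?thesis
      unfolding doubled_cycle_dist_eq_iff[OF n(1) arc] by auto
  qed
  from opposite[OF _ _ this[OF x]] opposite[OF _ _ this[OF y]] x(1) y(1) show ?thesis by simp
qed

lemma ex_arc_unresolved_by_twins:
  assumes n: "n \<ge> 3" "even n" and u: "u \<in> {1..n - 1}"
  obtains v w where "(v, w) \<in> parcs (doubled_cycle n)"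
    and "\<And>x. x \<in> {1..n} \<Longrightarrow> untwin n x = u \<Longrightarrow> doubled_cycle_dist n x v = doubled_cycle_dist n x w"
proof -
  obtain k where k: "n = 2 * k" using n(2) by (rule evenE)
  \<comment> \<open>The cycle has length \<open>2 * k - 1\<close>. The edge opposite to
    \<open>u\<close> has both ends at distance \<open>k - 1\<close>; it is the closing edge exactly
    when \<open>u = k\<close>.\<close>
  consider "u < k" | "u = k" | "u > k" by linarith
  then show ?thesis
  proof cases
    case 1
    show ?thesis
      by (rule that[of "u + k - 1" "u + k"])
        (use 1 n u k in \<open>auto simp: parcs_doubled_cycle doubled_cycle_dist_defs min_def split: if_splits\<close>)
  next
    case 2
    show ?thesis
      by (rule that[of 1 "n - 1"])
        (use 2 n u k in \<open>auto simp: parcs_doubled_cycle doubled_cycle_dist_defs min_def split: if_splits\<close>)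
  next
    case 3
    show ?thesis
      by (rule that[of "u - k" "u - k + 1"])
        (use 3 n u k in \<open>auto simp: parcs_doubled_cycle doubled_cycle_dist_defs min_def split: if_splits\<close>)
  qed
qed

section \<open>Values of the local fractional metric dimension\<close>

lemma local_resolving_function_doubled_cycle:
  assumes "n \<ge> 3"
  shows "local_resolving_function (doubled_cycle n) \<zeta> \<longleftrightarrow> \<zeta> \<in> {1..n} \<rightarrow> {0..1} \<and>
    (\<forall>(v, w) \<in> parcs (doubled_cycle n).
      (\<Sum>u \<in> {u \<in> {1..n}. doubled_cycle_dist n u v \<noteq> doubled_cycle_dist n u w}. \<zeta> u) \<ge> 1)"
  using assms by (auto simp: local_resolving_function_def resolving_nbhd_doubled_cycle)

lemma ldim_f_doubled_cycle_odd:
  assumes n: "n \<ge> 3" "odd n"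
  shows "ldim_f (doubled_cycle n) = 1"
proof (rule ldim_f_eqI)
  let ?\<zeta> = "\<lambda>u::nat. if u = 1 then 1 else 0 :: real"
  show "local_resolving_function (doubled_cycle n) ?\<zeta>"
    using n one_resolves_doubled_cycle[OF n]
    by (auto simp: local_resolving_function_doubled_cycle)
  show "(\<Sum>v \<in> pverts (doubled_cycle n). ?\<zeta> v) = 1"
    using n by simp
next
  fix \<eta> assume "local_resolving_function (doubled_cycle n) \<eta>"
  \<comment> \<open>For the lower bound the constraint of a single edge suffices.\<close>
  moreover have "(1, 2) \<in> parcs (doubled_cycle n)"
    using n by (simp add: parcs_doubled_cycle)
  ultimately have "\<eta> \<in> {1..n} \<rightarrow> {0..1}" and
    "1 \<le> (\<Sum>u \<in> {u \<in> {1..n}. doubled_cycle_dist n u 1 \<noteq> doubled_cycle_dist n u 2}. \<eta> u)"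
    using n by (auto simp: local_resolving_function_doubled_cycle)
  moreover from this have "\<dots> \<le> (\<Sum>u \<in> {1..n}. \<eta> u)"
    by (intro sum_mono2) (auto simp: Pi_iff)
  ultimately show "1 \<le> (\<Sum>v \<in> pverts (doubled_cycle n). \<eta> v)" by simp
qed

lemma ldim_f_doubled_cycle_even:
  assumes n: "n \<ge> 3" "even n"
  shows "ldim_f (doubled_cycle n) = (real n - 1) / (real n - 2)"
proof (rule ldim_f_eqI)
  \<comment> \<open>With weight 0 on the twin \<open>n\<close>, a sum of weights just counts cycle
    vertices; each edge is resolved by at least \<open>n - 2\<close> of these.\<close>
  let ?\<zeta> = "\<lambda>u. if u = n then 0 else 1 / (real n - 2)"
  have restrict: "(\<Sum>u \<in> A. ?\<zeta> u) = real (card (A \<inter> {1..n - 1})) / (real n - 2)"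
    if "A \<subseteq> {1..n}" for A
  proof -
    have "finite A" using that finite_subset by blast
    then have "(\<Sum>u \<in> A. ?\<zeta> u) = (\<Sum>u \<in> A \<inter> {1..n - 1}. ?\<zeta> u)"
      using that n by (intro sum.mono_neutral_right) (auto simp: subset_iff)
    also have "\<dots> = (\<Sum>u \<in> A \<inter> {1..n - 1}. 1 / (real n - 2))"
      using n by (intro sum.cong) auto
    finally show ?thesis by simp
  qed
  have "1 \<le> (\<Sum>u \<in> {u \<in> {1..n}. doubled_cycle_dist n u v \<noteq> doubled_cycle_dist n u w}. ?\<zeta> u)"
    if arc: "(v, w) \<in> parcs (doubled_cycle n)" for v w
  proof -
    let ?R = "{u \<in> {1..n}. doubled_cycle_dist n u v \<noteq> doubled_cycle_dist n u w}"
    let ?M = "{u \<in> {1..n - 1}. doubled_cycle_dist n u v = doubled_cycle_dist n u w}"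
    have "card ?M \<le> Suc 0"
      using unresolving_cycle_vertex_unique[OF n arc] by (subst card_le_Suc0_iff_eq) auto
    moreover have "card ({1..n - 1} - ?M) = card {1..n - 1} - card ?M"
      by (intro card_Diff_subset) auto
    moreover have "?R \<inter> {1..n - 1} = {1..n - 1} - ?M" by auto
    ultimately have "card (?R \<inter> {1..n - 1}) \<ge> n - 2" by simp
    then have "real (card (?R \<inter> {1..n - 1})) \<ge> real n - 2" using n by linarith
    then show ?thesis
      using n by (subst restrict) (auto simp: field_simps)
  qed
  then show "local_resolving_function (doubled_cycle n) ?\<zeta>"
    using n by (auto simp: local_resolving_function_doubled_cycle)
  have "{1..n} \<inter> {1..n - 1} = {1..n - 1}" by auto
  then show "(\<Sum>v \<in> pverts (doubled_cycle n). ?\<zeta> v) = (real n - 1) / (real n - 2)"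
    using restrict[of "{1..n}"] n by (simp add: of_nat_diff)
next
  fix \<eta> assume \<eta>: "local_resolving_function (doubled_cycle n) \<eta>"
  define s where "s = (\<Sum>u \<in> {1..n}. \<eta> u)"
  \<comment> \<open>The vertices that fold to \<open>u\<close> all fail to resolve the edge opposite
    to \<open>u\<close>, so they are disjoint from a resolving set that already carries weight at
    least 1.\<close>
  have twins: "(\<Sum>x \<in> {x \<in> {1..n}. untwin n x = u}. \<eta> x) \<le> s - 1" if u: "u \<in> {1..n - 1}" for u
  proof -
    obtain v w where arc: "(v, w) \<in> parcs (doubled_cycle n)"
      and eq: "\<And>x. x \<in> {1..n} \<Longrightarrow> untwin n x = u \<Longrightarrow>
        doubled_cycle_dist n x v = doubled_cycle_dist n x w"
      using ex_arc_unresolved_by_twins[OF n u] by blast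
    let ?R = "{x \<in> {1..n}. doubled_cycle_dist n x v \<noteq> doubled_cycle_dist n x w}"
    let ?T = "{x \<in> {1..n}. untwin n x = u}"
    have "1 \<le> sum \<eta> ?R"
      using \<eta> arc n by (auto simp: local_resolving_function_doubled_cycle)
    moreover have "sum \<eta> ?R + sum \<eta> ?T = sum \<eta> (?R \<union> ?T)"
      using eq by (intro sum.union_disjoint[symmetric]) auto
    moreover have "sum \<eta> (?R \<union> ?T) \<le> s"
      unfolding s_def using \<eta> n
      by (intro sum_mono2) (auto simp: local_resolving_function_doubled_cycle Pi_iff)
    ultimately show ?thesis by linarith
  qed
  \<comment> \<open>The fibres of \<open>untwin\<close> partition the vertices into
    \<open>n - 1\<close> groups. Adding their bounds gives \<open>s \<le> (n - 1) * (s - 1)\<close>,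
    which is then solved for \<open>s\<close>.\<close>
  have "s = (\<Sum>u \<in> {1..n - 1}. \<Sum>x \<in> {x \<in> {1..n}. untwin n x = u}. \<eta> x)"
    unfolding s_def using n by (intro sum.group[symmetric]) (auto simp: untwin_def)
  also have "\<dots> \<le> (\<Sum>u \<in> {1..n - 1}. s - 1)" by (intro sum_mono twins)
  also have "\<dots> = (real n - 1) * (s - 1)" using n by (simp add: of_nat_diff)
  finally have "(real n - 1) / (real n - 2) \<le> s" using n by (simp add: field_simps)
  then show "(real n - 1) / (real n - 2) \<le> (\<Sum>v \<in> pverts (doubled_cycle n). \<eta> v)"
    by (simp add: s_def)
qed

theorem theorem2:
  fixes n :: nat
  assumes "n \<ge> 3"
  shows "(odd n \<longrightarrow> ldim_f (toeplitz_graph n {1, n - 2}) = 1) \<and>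
    (even n \<longrightarrow>
      real n / (real n - 1) \<le> ldim_f (toeplitz_graph n {1, n - 2}) \<and>
      ldim_f (toeplitz_graph n {1, n - 2}) \<le> real n / (real n - 2))"
proof -
  \<comment> \<open>The first inequality amounts to
    \<open>n * (n - 2) \<le> (n - 1) * (n - 1)\<close> after clearing the positive
    denominators.\<close>
  have "real n / (real n - 1) \<le> (real n - 1) / (real n - 2)"
    "(real n - 1) / (real n - 2) \<le> real n / (real n - 2)"
    using assms by (auto simp: divide_simps algebra_simps)
  then show ?thesis
    using assms ldim_f_doubled_cycle_odd[of n] ldim_f_doubled_cycle_even[of n]
    by (simp add: doubled_cycle_def)
qed

end
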